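(* (Progress for the Parameterized Cast Calculus.) Fix any CastStruct. For every type $A$ and every closed term $M:\emptyset\vdash A$ of $CC(\Rightarrow)$, one of the following holds: 1. $M\longrightarrow M'$ for some $M'$; 2. $M$ is a value; 3. $M=\mathtt{blame}\,\ell$ for some blame label $\ell$.
   Context: **Types.** Base types $b$: $\mathtt{Nat},\mathtt{Bool},\mathtt{Int},\mathtt{Unit},\bot$. Types: $A,B::=b\mid\,?\mid A\to B\mid A\times B\mid A+B$. Contexts $\Gamma$ are finite sequences of types ($\emptyset$, $\Gamma\cdot A$); variables are de Bruijn indices (index $0$ is the last-added type). Primitive types $P::=b\mid b\to P$; each $b$ denotes a set (naturals, Booleans, integers, one-element set, empty set) and $[\![b\to P]\!]$ is the set of functions $[\![b]\!]\to[\![P]\!]$. Blame labels $\ell$ range over a fixed set. **PreCastStruct**: for all types $A,B$ a set $A\Rightarrow B$ of casts; predicates $\mathsf{Inert}$, $\mathsf{Active}$, $\mathsf{Cross}$ on casts; every cast is active or inert; every inert cast $c:A\Rightarrow(B\otimes C)$ with $\otimes\in\{\to,\times,+\}$ is a cross cast and $A=A_1\otimes A_2$ for some $A_1,A_2$; no cast $c:A\Rightarrow b$ into a base type is inert; and operations taking a cast $c$ and a proof $x$ of $\mathsf{Cross}\,c$: for $c:(A_1\to A_2)\Rightarrow(B_1\to B_2)$, $\mathsf{dom}\,c\,x:B_1\Rightarrow A_1$ and $\mathsf{cod}\,c\,x:A_2\Rightarrow B_2$; for $c:(A_1\times A_2)\Rightarrow(B_1\times B_2)$, $\mathsf{fst}\,c\,x:A_1\Rightarrow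 B_1$ and $\mathsf{snd}\,c\,x:A_2\Rightarrow B_2$; for $c:(A_1+A_2)\Rightarrow(B_1+B_2)$, $\mathsf{inl}\,c\,x:A_1\Rightarrow B_1$ and $\mathsf{inr}\,c\,x:A_2\Rightarrow B_2$. A **CastStruct** is a PreCastStruct together with an operation giving, for each value $V:\Gamma\vdash A$, cast $c:A\Rightarrow B$ and proof $a$ of $\mathsf{Active}\,c$, a term $\mathsf{applyCast}\,V\,c\,a:\Gamma\vdash B$. **Terms** of $CC(\Rightarrow)$ (intrinsically typed; $M:\Gamma\vdash A$): $\$k:\Gamma\vdash P$ for $k\in[\![P]\!]$; $`x:\Gamma\vdash A$ if $x$ has type $A$ in $\Gamma$; $\lambda M:\Gamma\vdash A\to B$ if $M:\Gamma\cdot A\vdash B$; $L\,M:\Gamma\vdash B$ if $L:\Gamma\vdash A\to B$, $M:\Gamma\vdash A$; $\mathtt{if}\,L\,M\,N:\Gamma\vdash B$ if $L:\Gamma\vdash\mathtt{Bool}$ and $M,N:\Gamma\vdash B$; $\mathtt{cons}\,M\,N:\Gamma\vdash A\times B$ if $M:\Gamma\vdash A$, $N:\Gamma\vdash B$; $\pi_iM:\Gamma\vdash A_i$ if $M:\Gamma\vdash A_1\times A_2$; $\mathtt{inl}[B]M:\Gamma\vdash A+B$ if $M:\Gamma\vdash A$; $\mathtt{inr}[A]M:\Gamma\vdash A+B$ if $M:\Gamma\vdash B$; $\mathtt{case}\,L\,M\,N:\Gamma\vdash B$ if $L:\Gamma\vdash A_1+A_2$, $M:\Gamma\vdash A_1\to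 B$, $N:\Gamma\vdash A_2\to B$; $M\langle c\rangle:\Gamma\vdash B$ if $M:\Gamma\vdash A$ and $c:A\Rightarrow B$; $\mathtt{blame}\,\ell:\Gamma\vdash A$ for every $A$. **Values** $V,W$: $\lambda M$; $\$k$; $\mathtt{cons}\,V\,W$; $\mathtt{inl}[B]V$; $\mathtt{inr}[A]V$; $V\langle c\rangle$ with $c$ inert. **Frames** $F$: $\Box\,M$; $V\,\Box$; $\mathtt{if}\,\Box\,M\,N$; $\mathtt{cons}\,V\,\Box$; $\mathtt{cons}\,\Box\,N$; $\pi_i\Box$; $\mathtt{inl}[B]\Box$; $\mathtt{inr}[A]\Box$; $\mathtt{case}\,\Box\,M\,N$; $\Box\langle c\rangle$. $F[M]$ fills the hole. **Reduction** $M\longrightarrow M'$ ($M[V]$ is substitution of $V$ for variable $0$, lowering the other free indices; $\uparrow M$ is weakening by one variable): - $F[M]\longrightarrow F[M']$ if $M\longrightarrow M'$; $F[\mathtt{blame}\,\ell]\longrightarrow\mathtt{blame}\,\ell$. - $V\langle c\rangle\longrightarrow\mathsf{applyCast}\,V\,c\,a$ for $a:\mathsf{Active}\,c$. - For $c$ inert and $x:\mathsf{Cross}\,c$: $V\langle c\rangle\,W\longrightarrow(V\,(W\langle\mathsf{dom}\,c\,x\rangle))\langle\mathsf{cod}\,c\,x\rangle$; $\pi_1(V\langle c\rangle)\longrightarrow(\pi_1V)\langle\mathsf{fst}\,c\,x\rangle$; $\pi_2(V\langle c\rangle)\longrightarrow(\pi_2V)\langle\mathsf{snd}\,c\,x\rangle$;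 $\mathtt{case}\,(V\langle c\rangle)\,M\,N\longrightarrow\mathtt{case}\,V\,(\lambda((\uparrow M)\,(`0\langle\mathsf{inl}\,c\,x\rangle)))\,(\lambda((\uparrow N)\,(`0\langle\mathsf{inr}\,c\,x\rangle)))$. - $(\lambda M)\,V\longrightarrow M[V]$; $\mathtt{if}\,\$\mathtt{true}\,M\,N\longrightarrow M$; $\mathtt{if}\,\$\mathtt{false}\,M\,N\longrightarrow N$; $\pi_1(\mathtt{cons}\,V\,W)\longrightarrow V$; $\pi_2(\mathtt{cons}\,V\,W)\longrightarrow W$; $\mathtt{case}\,(\mathtt{inl}[B]V)\,L\,M\longrightarrow L\,V$; $\mathtt{case}\,(\mathtt{inr}[A]V)\,L\,M\longrightarrow M\,V$; $\$k\,\$k'\longrightarrow\$(k(k'))$. *)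

theory Defs
  imports Main "HOL-Library.FuncSet"
begin

section \<open>Types and constants\<close>

datatype base = TNat | TBool | TInt | TUnit | TBot

datatype ty = Base base | Dyn | Fun ty ty | Prod ty ty | Sum ty ty

datatype prim = PBase base | PFun base prim

fun ty_of_prim :: "prim \<Rightarrow> ty" where
  "ty_of_prim (PBase b) = Base b"
| "ty_of_prim (PFun b P) = Fun (Base b) (ty_of_prim P)"

datatype bval = VNat nat | VBool bool | VInt int | VUnit

fun bvals :: "base \<Rightarrow> bval set" where
  "bvals TNat = range VNat"
| "bvals TBool = range VBool"
| "bvals TInt = range VInt"
| "bvals TUnit = {VUnit}"
| "bvals TBot = {}"

text \<open>
  All the sets denoted by primitive types live in the single type \<open>konst\<close>. A function from
  the set of \<open>b\<close> to the set of \<open>P\<close> is represented by its extensional extension to all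
  of \<open>bval\<close>, so that the elements of \<open>denote (PFun b P)\<close> are exactly the functions
  \<open>bvals b \<rightarrow> denote P\<close>.
\<close>

datatype konst = KBase bval | KFun "bval \<Rightarrow> konst"

fun denote :: "prim \<Rightarrow> konst set" where
  "denote (PBase b) = KBase ` bvals b"
| "denote (PFun b P) = KFun ` (bvals b \<rightarrow>\<^sub>E denote P)"


section \<open>Terms\<close>

text \<open>
  Intrinsically typed terms are represented by raw terms together with a typing derivation.
  \<open>Lam\<close>, \<open>Const\<close>, \<open>InL\<close>, \<open>InR\<close> and \<open>Blame\<close> carry the type that an intrinsically
  typed term would carry implicitly, so that in a given context a raw term has at most one type
  (see \<open>has_type_unique\<close> below) and at most one derivation. Here \<open>'c\<close> is the type of casts
  and \<open>'l\<close> the type of blame labels; variables are de Bruijn indices, and only \<open>Lam\<close> binds.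
\<close>

datatype ('c, 'l) trm =
    Const prim konst
  | Var nat
  | Lam ty "('c, 'l) trm"
  | App "('c, 'l) trm" "('c, 'l) trm"
  | Ite "('c, 'l) trm" "('c, 'l) trm" "('c, 'l) trm"
  | MkPair "('c, 'l) trm" "('c, 'l) trm"
  | Fst "('c, 'l) trm"
  | Snd "('c, 'l) trm"
  | InL ty "('c, 'l) trm"
  | InR ty "('c, 'l) trm"
  | Case "('c, 'l) trm" "('c, 'l) trm" "('c, 'l) trm"
  | Cast "('c, 'l) trm" 'c
  | Blame ty 'l

primrec lift :: "nat \<Rightarrow> ('c, 'l) trm \<Rightarrow> ('c, 'l) trm" where
  "lift n (Const P k) = Const P k"
| "lift n (Var i) = (if i < n then Var i else Var (Suc i))"
| "lift n (Lam A M) = Lam A (lift (Suc n) M)"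
| "lift n (App L M) = App (lift n L) (lift n M)"
| "lift n (Ite L M N) = Ite (lift n L) (lift n M) (lift n N)"
| "lift n (MkPair M N) = MkPair (lift n M) (lift n N)"
| "lift n (Fst M) = Fst (lift n M)"
| "lift n (Snd M) = Snd (lift n M)"
| "lift n (InL B M) = InL B (lift n M)"
| "lift n (InR A M) = InR A (lift n M)"
| "lift n (Case L M N) = Case (lift n L) (lift n M) (lift n N)"
| "lift n (Cast M c) = Cast (lift n M) c"
| "lift n (Blame A l) = Blame A l"

abbreviation weaken :: "('c, 'l) trm \<Rightarrow> ('c, 'l) trm" where
  "weaken \<equiv> lift 0"

text \<open>\<open>subst n V M\<close> replaces variable \<open>n\<close> of \<open>M\<close> by \<open>V\<close> and lowers the variables above \<open>n\<close>.\<close>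

primrec subst :: "nat \<Rightarrow> ('c, 'l) trm \<Rightarrow> ('c, 'l) trm \<Rightarrow> ('c, 'l) trm" where
  "subst n V (Const P k) = Const P k"
| "subst n V (Var i) = (if i < n then Var i else if i = n then V else Var (i - 1))"
| "subst n V (Lam A M) = Lam A (subst (Suc n) (weaken V) M)"
| "subst n V (App L M) = App (subst n V L) (subst n V M)"
| "subst n V (Ite L M N) = Ite (subst n V L) (subst n V M) (subst n V N)"
| "subst n V (MkPair M N) = MkPair (subst n V M) (subst n V N)"
| "subst n V (Fst M) = Fst (subst n V M)"
| "subst n V (Snd M) = Snd (subst n V M)"
| "subst n V (InL B M) = InL B (subst n V M)"
| "subst n V (InR A M) = InR A (subst n V M)"
| "subst n V (Case L M N) = Case (subst n V L) (subst n V M) (subst n V N)"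
| "subst n V (Cast M c) = Cast (subst n V M) c"
| "subst n V (Blame A l) = Blame A l"


section \<open>Cast structures\<close>

text \<open>
  The family of sets of casts \<open>A \<Rightarrow> B\<close>, indexed by pairs of types, is given by its disjoint
  union \<open>casts\<close> with the index maps \<open>src\<close> and \<open>tgt\<close>. Operations that take a proof of
  \<open>cross c\<close> or \<open>active c\<close> become total functions that are constrained only where that
  predicate holds. \<open>apply_cast\<close> also receives the context of the value, which an
  intrinsically typed value determines.
\<close>

record 'c pre_cast_struct =
  casts :: "'c set"
  src :: "'c \<Rightarrow> ty"
  tgt :: "'c \<Rightarrow> ty"
  inert :: "'c \<Rightarrow> bool"
  active :: "'c \<Rightarrow> bool"
  cross :: "'c \<Rightarrow> bool"
  dom_cast :: "'c \<Rightarrow> 'c"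
  cod_cast :: "'c \<Rightarrow> 'c"
  fst_cast :: "'c \<Rightarrow> 'c"
  snd_cast :: "'c \<Rightarrow> 'c"
  inl_cast :: "'c \<Rightarrow> 'c"
  inr_cast :: "'c \<Rightarrow> 'c"

record ('c, 'l) cast_struct = "'c pre_cast_struct" +
  apply_cast :: "ty list \<Rightarrow> ('c, 'l) trm \<Rightarrow> 'c \<Rightarrow> ('c, 'l) trm"

definition is_cast :: "('c, 'z) pre_cast_struct_scheme \<Rightarrow> 'c \<Rightarrow> ty \<Rightarrow> ty \<Rightarrow> bool" where
  "is_cast S c A B \<longleftrightarrow> c \<in> casts S \<and> src S c = A \<and> tgt S c = B"

locale pre_cast_struct =
  fixes S :: "('c, 'z) pre_cast_struct_scheme"
  assumes active_or_inert: "c \<in> casts S \<Longrightarrow> active S c \<or> inert S c"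
    and inert_Fun: "is_cast S c A (Fun B C) \<Longrightarrow> inert S c \<Longrightarrow>
      cross S c \<and> (\<exists>A1 A2. A = Fun A1 A2)"
    and inert_Prod: "is_cast S c A (Prod B C) \<Longrightarrow> inert S c \<Longrightarrow>
      cross S c \<and> (\<exists>A1 A2. A = Prod A1 A2)"
    and inert_Sum: "is_cast S c A (Sum B C) \<Longrightarrow> inert S c \<Longrightarrow>
      cross S c \<and> (\<exists>A1 A2. A = Sum A1 A2)"
    and not_inert_Base: "is_cast S c A (Base b) \<Longrightarrow> \<not> inert S c"
    and dom_cast: "is_cast S c (Fun A1 A2) (Fun B1 B2) \<Longrightarrow> cross S c \<Longrightarrow>
      is_cast S (dom_cast S c) B1 A1"
    and cod_cast: "is_cast S c (Fun A1 A2) (Fun B1 B2) \<Longrightarrow> cross S c \<Longrightarrow>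
      is_cast S (cod_cast S c) A2 B2"
    and fst_cast: "is_cast S c (Prod A1 A2) (Prod B1 B2) \<Longrightarrow> cross S c \<Longrightarrow>
      is_cast S (fst_cast S c) A1 B1"
    and snd_cast: "is_cast S c (Prod A1 A2) (Prod B1 B2) \<Longrightarrow> cross S c \<Longrightarrow>
      is_cast S (snd_cast S c) A2 B2"
    and inl_cast: "is_cast S c (Sum A1 A2) (Sum B1 B2) \<Longrightarrow> cross S c \<Longrightarrow>
      is_cast S (inl_cast S c) A1 B1"
    and inr_cast: "is_cast S c (Sum A1 A2) (Sum B1 B2) \<Longrightarrow> cross S c \<Longrightarrow>
      is_cast S (inr_cast S c) A2 B2"

text \<open>Contexts are lists whose head is the type of variable \<open>0\<close>.\<close>

inductive has_type ::
  "('c, 'z) pre_cast_struct_scheme \<Rightarrow> ty list \<Rightarrow> ('c, 'l) trm \<Rightarrow> ty \<Rightarrow> bool"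
  for S where
  "k \<in> denote P \<Longrightarrow> has_type S \<Gamma> (Const P k) (ty_of_prim P)"
| "i < length \<Gamma> \<Longrightarrow> has_type S \<Gamma> (Var i) (\<Gamma> ! i)"
| "has_type S (A # \<Gamma>) M B \<Longrightarrow> has_type S \<Gamma> (Lam A M) (Fun A B)"
| "has_type S \<Gamma> L (Fun A B) \<Longrightarrow> has_type S \<Gamma> M A \<Longrightarrow> has_type S \<Gamma> (App L M) B"
| "has_type S \<Gamma> L (Base TBool) \<Longrightarrow> has_type S \<Gamma> M B \<Longrightarrow> has_type S \<Gamma> N B \<Longrightarrow>
     has_type S \<Gamma> (Ite L M N) B"
| "has_type S \<Gamma> M A \<Longrightarrow> has_type S \<Gamma> N B \<Longrightarrow> has_type S \<Gamma> (MkPair M N) (Prod A B)"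
| "has_type S \<Gamma> M (Prod A B) \<Longrightarrow> has_type S \<Gamma> (Fst M) A"
| "has_type S \<Gamma> M (Prod A B) \<Longrightarrow> has_type S \<Gamma> (Snd M) B"
| "has_type S \<Gamma> M A \<Longrightarrow> has_type S \<Gamma> (InL B M) (Sum A B)"
| "has_type S \<Gamma> M B \<Longrightarrow> has_type S \<Gamma> (InR A M) (Sum A B)"
| "has_type S \<Gamma> L (Sum A1 A2) \<Longrightarrow> has_type S \<Gamma> M (Fun A1 B) \<Longrightarrow> has_type S \<Gamma> N (Fun A2 B) \<Longrightarrow>
     has_type S \<Gamma> (Case L M N) B"
| "has_type S \<Gamma> M A \<Longrightarrow> is_cast S c A B \<Longrightarrow> has_type S \<Gamma> (Cast M c) B"
| "has_type S \<Gamma> (Blame A l) A"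

inductive_cases has_type_elims:
  "has_type S \<Gamma> (Const P k) A"
  "has_type S \<Gamma> (Var i) A"
  "has_type S \<Gamma> (Lam B M) A"
  "has_type S \<Gamma> (App L M) A"
  "has_type S \<Gamma> (Ite L M N) A"
  "has_type S \<Gamma> (MkPair M N) A"
  "has_type S \<Gamma> (Fst M) A"
  "has_type S \<Gamma> (Snd M) A"
  "has_type S \<Gamma> (InL B M) A"
  "has_type S \<Gamma> (InR B M) A"
  "has_type S \<Gamma> (Case L M N) A"
  "has_type S \<Gamma> (Cast M c) A"
  "has_type S \<Gamma> (Blame B l) A"

lemma has_type_unique:
  "has_type S \<Gamma> M A \<Longrightarrow> has_type S \<Gamma> M B \<Longrightarrow> A = B"
proof (induction M arbitrary: \<Gamma> A B)
  case (Cast M c)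
  then show ?case by (auto simp: is_cast_def elim!: has_type_elims)
qed (elim has_type_elims; blast)+

inductive "value" :: "('c, 'z) pre_cast_struct_scheme \<Rightarrow> ('c, 'l) trm \<Rightarrow> bool"
  for S where
  "value S (Lam A M)"
| "value S (Const P k)"
| "value S V \<Longrightarrow> value S W \<Longrightarrow> value S (MkPair V W)"
| "value S V \<Longrightarrow> value S (InL B V)"
| "value S V \<Longrightarrow> value S (InR A V)"
| "value S V \<Longrightarrow> inert S c \<Longrightarrow> value S (Cast V c)"

locale cast_struct = pre_cast_struct S for S :: "('c, 'l) cast_struct" +
  assumes apply_cast: "has_type S \<Gamma> V A \<Longrightarrow> value S V \<Longrightarrow> is_cast S c A B \<Longrightarrow> active S c \<Longrightarrow>
      has_type S \<Gamma> (apply_cast S \<Gamma> V c) B"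


section \<open>Reduction\<close>

datatype ('c, 'l) frame =
    FAppL "('c, 'l) trm"
  | FAppR "('c, 'l) trm"
  | FIte "('c, 'l) trm" "('c, 'l) trm"
  | FPairR "('c, 'l) trm"
  | FPairL "('c, 'l) trm"
  | FFst
  | FSnd
  | FInL ty
  | FInR ty
  | FCase "('c, 'l) trm" "('c, 'l) trm"
  | FCast 'c

primrec plug :: "('c, 'l) frame \<Rightarrow> ('c, 'l) trm \<Rightarrow> ('c, 'l) trm" where
  "plug (FAppL M) X = App X M"
| "plug (FAppR V) X = App V X"
| "plug (FIte M N) X = Ite X M N"
| "plug (FPairR V) X = MkPair V X"
| "plug (FPairL N) X = MkPair X N"
| "plug FFst X = Fst X"
| "plug FSnd X = Snd X"
| "plug (FInL B) X = InL B X"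
| "plug (FInR A) X = InR A X"
| "plug (FCase M N) X = Case X M N"
| "plug (FCast c) X = Cast X c"

primrec is_frame :: "('c, 'z) pre_cast_struct_scheme \<Rightarrow> ('c, 'l) frame \<Rightarrow> bool" where
  "is_frame S (FAppL M) \<longleftrightarrow> True"
| "is_frame S (FAppR V) \<longleftrightarrow> value S V"
| "is_frame S (FIte M N) \<longleftrightarrow> True"
| "is_frame S (FPairR V) \<longleftrightarrow> value S V"
| "is_frame S (FPairL N) \<longleftrightarrow> True"
| "is_frame S FFst \<longleftrightarrow> True"
| "is_frame S FSnd \<longleftrightarrow> True"
| "is_frame S (FInL B) \<longleftrightarrow> True"
| "is_frame S (FInR A) \<longleftrightarrow> True"
| "is_frame S (FCase M N) \<longleftrightarrow> True"
| "is_frame S (FCast c) \<longleftrightarrow> True"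

text \<open>
  Reduction of terms in context \<open>\<Gamma>\<close>; it is meant for terms that are well typed in \<open>\<Gamma>\<close>. No rule
  reduces under a binder, so \<open>\<Gamma>\<close> is fixed; it is needed for \<open>apply_cast\<close> and for the type
  annotation of the \<open>Blame\<close> produced by a frame.
\<close>

inductive reduces ::
  "('c, 'l) cast_struct \<Rightarrow> ty list \<Rightarrow> ('c, 'l) trm \<Rightarrow> ('c, 'l) trm \<Rightarrow> bool"
  for S \<Gamma> where
  "is_frame S F \<Longrightarrow> reduces S \<Gamma> M M' \<Longrightarrow> reduces S \<Gamma> (plug F M) (plug F M')"
| "is_frame S F \<Longrightarrow> has_type S \<Gamma> (plug F (Blame A l)) B \<Longrightarrow>
     reduces S \<Gamma> (plug F (Blame A l)) (Blame B l)"
| "value S V \<Longrightarrow> active S c \<Longrightarrow> reduces S \<Gamma> (Cast V c) (apply_cast S \<Gamma> V c)"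
| "value S V \<Longrightarrow> value S W \<Longrightarrow> is_cast S c (Fun A1 A2) (Fun B1 B2) \<Longrightarrow> inert S c \<Longrightarrow> cross S c \<Longrightarrow>
     reduces S \<Gamma> (App (Cast V c) W) (Cast (App V (Cast W (dom_cast S c))) (cod_cast S c))"
| "value S V \<Longrightarrow> is_cast S c (Prod A1 A2) (Prod B1 B2) \<Longrightarrow> inert S c \<Longrightarrow> cross S c \<Longrightarrow>
     reduces S \<Gamma> (Fst (Cast V c)) (Cast (Fst V) (fst_cast S c))"
| "value S V \<Longrightarrow> is_cast S c (Prod A1 A2) (Prod B1 B2) \<Longrightarrow> inert S c \<Longrightarrow> cross S c \<Longrightarrow>
     reduces S \<Gamma> (Snd (Cast V c)) (Cast (Snd V) (snd_cast S c))"
| "value S V \<Longrightarrow> is_cast S c (Sum A1 A2) (Sum B1 B2) \<Longrightarrow> inert S c \<Longrightarrow> cross S c \<Longrightarrow>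
     reduces S \<Gamma> (Case (Cast V c) M N)
       (Case V (Lam A1 (App (weaken M) (Cast (Var 0) (inl_cast S c))))
               (Lam A2 (App (weaken N) (Cast (Var 0) (inr_cast S c)))))"
| "value S V \<Longrightarrow> reduces S \<Gamma> (App (Lam A M) V) (subst 0 V M)"
| "reduces S \<Gamma> (Ite (Const (PBase TBool) (KBase (VBool True))) M N) M"
| "reduces S \<Gamma> (Ite (Const (PBase TBool) (KBase (VBool False))) M N) N"
| "value S V \<Longrightarrow> value S W \<Longrightarrow> reduces S \<Gamma> (Fst (MkPair V W)) V"
| "value S V \<Longrightarrow> value S W \<Longrightarrow> reduces S \<Gamma> (Snd (MkPair V W)) W"
| "value S V \<Longrightarrow> reduces S \<Gamma> (Case (InL B V) L M) (App L V)"
| "value S V \<Longrightarrow> reduces S \<Gamma> (Case (InR A V) L M) (App M V)"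
| "reduces S \<Gamma> (App (Const (PFun b P) (KFun f)) (Const (PBase b) (KBase v))) (Const P (f v))"

end

theory Submission imports Defs begin

text \<open>
  Typing derivations are inverted to find the shape of closed values at each type: an inert cast
  never targets a base type, and at \<open>Fun\<close>, \<open>Prod\<close> and \<open>Sum\<close> it is a cross cast between types with
  the same head constructor, so that a distribution rule fires. Since terms are raw, the reduct
  found by progress is shown to be well typed by a separate preservation theorem.
\<close>

section \<open>Weakening and substitution\<close>

text \<open>The new type is inserted below an arbitrary prefix \<Gamma>, not at the head, so that
  the induction passes under \<open>Lam\<close>, where the bound variable extends the
  prefix.\<close>

lemma has_type_lift:
  assumes "has_type S (\<Gamma> @ \<Delta>) M A"
  shows "has_type S (\<Gamma> @ B # \<Delta>) (lift (length \<Gamma>) M) A"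
  using assms
proof (induction "\<Gamma> @ \<Delta>" M A arbitrary: \<Gamma> rule: has_type.induct)
  case (2 i)
  show ?case
  proof (cases "i < length \<Gamma>")
    case True
    then show ?thesis
      using has_type.intros(2)[of i "\<Gamma> @ B # \<Delta>" S] by (simp add: nth_append)
  next
    case False
    then show ?thesis
      using 2 has_type.intros(2)[of "Suc i" "\<Gamma> @ B # \<Delta>" S]
      by (simp add: nth_append Suc_diff_le)
  qed
next
  case (3 A M C)
  then have "has_type S ((A # \<Gamma>) @ B # \<Delta>) (lift (length (A # \<Gamma>)) M) C"
    by (metis append_Cons)
  then show ?case by (auto intro: has_type.intros)
qed (auto intro: has_type.intros)

corollary has_type_weaken:
  "has_type S \<Gamma> M A \<Longrightarrow> has_type S (B # \<Gamma>) (weaken M) A"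
  using has_type_lift[of S "[]"] by simp

lemma has_type_subst:
  assumes "has_type S (\<Gamma> @ A # \<Delta>) M B" and "has_type S (\<Gamma> @ \<Delta>) V A"
  shows "has_type S (\<Gamma> @ \<Delta>) (subst (length \<Gamma>) V M) B"
  using assms
\<comment> \<open>\<open>V\<close> is generalized along with \<Gamma> because \<open>subst\<close>
  weakens it under each \<open>Lam\<close>.\<close>
proof (induction "\<Gamma> @ A # \<Delta>" M B arbitrary: \<Gamma> V rule: has_type.induct)
  case (2 i)
  consider "i < length \<Gamma>" | "i = length \<Gamma>" | "length \<Gamma> < i"
    by linarith
  then show ?case
  proof cases
    case 1
    then show ?thesis
      using has_type.intros(2)[of i "\<Gamma> @ \<Delta>" S] by (simp add: nth_append)
  next
    case 2
    then show ?thesis using \<open>has_type S (\<Gamma> @ \<Delta>) V A\<close> by simp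
  next
    case 3
    \<comment> \<open>Above the removed variable, \<open>subst\<close> lowers the index by one, and
      position \<open>j\<close> of the shorter context holds the type of position
      \<open>Suc j\<close> of the longer one.\<close>
    then obtain j where "i = Suc j" "length \<Gamma> \<le> j"
      by (cases i) auto
    then show ?thesis
      using \<open>i < length (\<Gamma> @ A # \<Delta>)\<close> has_type.intros(2)[of j "\<Gamma> @ \<Delta>" S]
      by (simp add: nth_append Suc_diff_le)
  qed
next
  case (3 C M B)
  have "has_type S ((C # \<Gamma>) @ \<Delta>) (weaken V) A"
    using 3 by (simp add: has_type_weaken)
  then have "has_type S ((C # \<Gamma>) @ \<Delta>) (subst (length (C # \<Gamma>)) (weaken V) M) B"
    using 3 by (metis append_Cons)
  then show ?case by (auto intro: has_type.intros)
qed (auto intro: has_type.intros)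

corollary has_type_subst_0:
  "has_type S (A # \<Gamma>) M B \<Longrightarrow> has_type S \<Gamma> V A \<Longrightarrow> has_type S \<Gamma> (subst 0 V M) B"
  using has_type_subst[of S "[]"] by simp

section \<open>Preservation\<close>

lemma is_cast_unique:
  "is_cast S c A B \<Longrightarrow> is_cast S c A' B' \<Longrightarrow> A = A' \<and> B = B'"
  by (simp add: is_cast_def)

text \<open>The derivation around the hole uses only the type of what fills it. This reduces the
  congruence rule to the induction hypothesis at type \<open>A\<close>.\<close>

lemma has_type_plug:
  assumes "has_type S \<Gamma> (plug F M) B"
  obtains A where "has_type S \<Gamma> M A"
    and "\<And>N. has_type S \<Gamma> N A \<Longrightarrow> has_type S \<Gamma> (plug F N) B"
  using assms
  by (cases F) (auto elim!: has_type_elims intro: has_type.intros)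

context cast_struct
begin

theorem preservation:
  assumes "reduces S \<Gamma> M M'" and "has_type S \<Gamma> M A"
  shows "has_type S \<Gamma> M' A"
  using assms
proof (induction arbitrary: A rule: reduces.induct)
  case (1 F M M')
  then show ?case by (metis has_type_plug)
next
  case (2 F A' l B)
  \<comment> \<open>The rule annotates \<open>Blame\<close> with some type of the redex; uniqueness
    of types makes it the given one.\<close>
  then show ?case using has_type_unique by (blast intro: has_type.intros)
next
  case (3 V c)
  then show ?case by (auto elim!: has_type_elims intro: apply_cast)
next
  case (4 V W c A1 A2 B1 B2)
  then have "is_cast S (dom_cast S c) B1 A1" "is_cast S (cod_cast S c) A2 B2"
    using dom_cast cod_cast by blast+
  \<comment> \<open>A cast determines its source and target, so the types named in the rule agree
    with those obtained by inverting the typing of the redex.\<close>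
  moreover have "has_type S \<Gamma> V (Fun A1 A2)" "has_type S \<Gamma> W B1" "A = B2"
    using 4 by (auto elim!: has_type_elims dest: is_cast_unique)
  ultimately show ?case by (blast intro: has_type.intros)
next
  case (5 V c A1 A2 B1 B2)
  then have "is_cast S (fst_cast S c) A1 B1"
    using fst_cast by blast
  moreover have "has_type S \<Gamma> V (Prod A1 A2)" "A = B1"
    using 5 by (auto elim!: has_type_elims dest: is_cast_unique)
  ultimately show ?case by (blast intro: has_type.intros)
next
  case (6 V c A1 A2 B1 B2)
  then have "is_cast S (snd_cast S c) A2 B2"
    using snd_cast by blast
  moreover have "has_type S \<Gamma> V (Prod A1 A2)" "A = B2"
    using 6 by (auto elim!: has_type_elims dest: is_cast_unique)
  ultimately show ?case by (blast intro: has_type.intros)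
next
  case (7 V c A1 A2 B1 B2 M N)
  then have casts: "is_cast S (inl_cast S c) A1 B1" "is_cast S (inr_cast S c) A2 B2"
    using inl_cast inr_cast by blast+
  have "has_type S \<Gamma> V (Sum A1 A2)" "has_type S \<Gamma> M (Fun B1 A)" "has_type S \<Gamma> N (Fun B2 A)"
    using 7 by (auto elim!: has_type_elims dest: is_cast_unique)
  moreover have "has_type S (C # \<Gamma>) (Var 0) C" for C
    using has_type.intros(2)[of 0 "C # \<Gamma>" S] by simp
  ultimately show ?case
    using casts by (blast intro: has_type.intros has_type_weaken)
next
  case (8 V B M)
  then show ?case by (auto elim!: has_type_elims intro: has_type_subst_0)
next
  case (15 b P f v)
  then have "KFun f \<in> denote (PFun b P)" "KBase v \<in> denote (PBase b)" "A = ty_of_prim P"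
    by (auto elim!: has_type_elims)
  \<comment> \<open>Since \<open>KFun\<close> and \<open>KBase\<close> are injective,
    \<open>f\<close> lies in the extensional function space and \<open>v\<close> in its
    domain.\<close>
  then have "f v \<in> denote P"
    by (auto dest: PiE_mem)
  then show ?case
    using \<open>A = ty_of_prim P\<close> by (auto intro: has_type.intros)
qed (auto elim!: has_type_elims intro: has_type.intros)

section \<open>Canonical forms\<close>

lemma value_Base_cases:
  assumes "value S V" and "has_type S \<Gamma> V (Base b)"
  obtains v where "V = Const (PBase b) (KBase v)" and "v \<in> bvals b"
  using assms(1)
proof cases
  case (2 P k)
  then have "k \<in> denote P" "ty_of_prim P = Base b"
    using assms(2) by (auto elim: has_type_elims)
  then show ?thesis using that 2 by (cases P) auto
qed (use assms(2) not_inert_Base in \<open>auto elim: has_type_elims\<close>)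

text \<open>The constant case records \<open>A = Base b\<close> so that a value argument can be
  recognized as a constant, as primitive application requires.\<close>

lemma value_Fun_cases:
  assumes "value S V" and "has_type S \<Gamma> V (Fun A B)"
  obtains M where "V = Lam A M"
  | b P f where "V = Const (PFun b P) (KFun f)" and "A = Base b"
  | W c A1 A2 where "V = Cast W c" and "value S W" and "inert S c" and "cross S c"
      and "is_cast S c (Fun A1 A2) (Fun A B)"
  using assms(1)
proof cases
  case (2 P k)
  then have "k \<in> denote P" "ty_of_prim P = Fun A B"
    using assms(2) by (auto elim: has_type_elims)
  then show ?thesis using that(2) 2 by (cases P) auto
next
  case (6 W c)
  then obtain C where "is_cast S c C (Fun A B)"
    using assms(2) by (auto elim: has_type_elims)
  then show ?thesis using that(3) inert_Fun 6 by blast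
qed (use assms(2) that(1) in \<open>auto elim: has_type_elims\<close>)

text \<open>Constants have only base types and curried function types over them; these rules let
  \<open>auto\<close> discard constants at products and sums.\<close>

lemma ty_of_prim_neq [simp]:
  "ty_of_prim P \<noteq> Prod A B" "ty_of_prim P \<noteq> Sum A B"
  "Prod A B \<noteq> ty_of_prim P" "Sum A B \<noteq> ty_of_prim P"
  by (cases P; simp)+

lemma value_Prod_cases:
  assumes "value S V" and "has_type S \<Gamma> V (Prod A B)"
  obtains W1 W2 where "V = MkPair W1 W2" and "value S W1" and "value S W2"
  | W c A1 A2 where "V = Cast W c" and "value S W" and "inert S c" and "cross S c"
      and "is_cast S c (Prod A1 A2) (Prod A B)"
  using assms(1)
proof cases
  case (6 W c)
  then obtain C where "is_cast S c C (Prod A B)"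
    using assms(2) by (auto elim: has_type_elims)
  then show ?thesis using that(2) inert_Prod 6 by blast
qed (use assms(2) that(1) in \<open>auto elim: has_type_elims\<close>)

lemma value_Sum_cases:
  assumes "value S V" and "has_type S \<Gamma> V (Sum A B)"
  obtains W where "V = InL B W" and "value S W"
  | W where "V = InR A W" and "value S W"
  | W c A1 A2 where "V = Cast W c" and "value S W" and "inert S c" and "cross S c"
      and "is_cast S c (Sum A1 A2) (Sum A B)"
  using assms(1)
proof cases
  case (6 W c)
  then obtain C where "is_cast S c C (Sum A B)"
    using assms(2) by (auto elim: has_type_elims)
  then show ?thesis using that(3) inert_Sum 6 by blast
qed (use assms(2) that(1,2) in \<open>auto elim: has_type_elims\<close>)

section \<open>Progress\<close>

definition progresses :: "('c, 'l) trm \<Rightarrow> bool" where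
  "progresses M \<longleftrightarrow> (\<exists>M'. reduces S [] M M') \<or> value S M \<or> (\<exists>A l. M = Blame A l)"

lemma progresses_step: "reduces S [] M M' \<Longrightarrow> progresses M"
  by (auto simp: progresses_def)

text \<open>A step of \<open>M\<close> lifts by congruence, and a \<open>Blame\<close> propagates
  with the annotation \<open>B\<close> supplied by the typing hypothesis. Only the case of a value
  in the hole depends on the frame.\<close>

lemma progresses_plug:
  assumes "progresses M" and "is_frame S F" and "has_type S [] (plug F M) B"
    and "value S M \<Longrightarrow> progresses (plug F M)"
  shows "progresses (plug F M)"
  using assms unfolding progresses_def by (metis reduces.intros(1,2))

theorem progress: "has_type S [] M A \<Longrightarrow> progresses M"
proof (induction "[] :: ty list" M A rule: has_type.induct)
  case (1 k P)
  then show ?case by (simp add: progresses_def value.intros)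
next
  case (2 i)
  then show ?case by simp
next
  case (3 A M B)
  then show ?case by (simp add: progresses_def value.intros)
next
  case (4 L A B M)
  \<comment> \<open>Evaluation goes left to right: the case of two values comes first, then the
    frame around \<open>M\<close>, which needs \<open>L\<close> to be a value, and last the frame
    around \<open>L\<close>.\<close>
  have "progresses (App L M)" if "value S L" and M: "value S M"
    using value_Fun_cases[OF that(1) 4(1)]
  proof cases
    case (1 N)
    then show ?thesis
      using that by (auto intro: progresses_step reduces.intros)
  next
    case (2 b P f)
    then obtain v where "M = Const (PBase b) (KBase v)"
      using value_Base_cases M 4(3) by metis
    then show ?thesis
      using 2 by (auto intro: progresses_step reduces.intros)
  next
    case (3 W c A1 A2)
    then show ?thesis
      using that by (blast intro: progresses_step reduces.intros)
  qed
  then have "progresses (App L M)" if "value S L"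
    using progresses_plug[of M "FAppR L"] 4 that by (auto intro: has_type.intros)
  then show ?case
    using progresses_plug[of L "FAppL M"] 4 by (auto intro: has_type.intros)
next
  case (5 L M B N)
  have "progresses (Ite L M N)" if L: "value S L"
  proof -
    obtain v where "L = Const (PBase TBool) (KBase v)" "v \<in> bvals TBool"
      using value_Base_cases[OF L 5(1)] .
    then obtain b where "L = Const (PBase TBool) (KBase (VBool b))"
      by auto
    then show ?thesis
      by (cases b) (auto intro: progresses_step reduces.intros)
  qed
  then show ?case
    using progresses_plug[of L "FIte M N"] 5 by (auto intro: has_type.intros)
next
  case (6 M A N B)
  have "progresses (MkPair M N)" if "value S M" "value S N"
    using that by (simp add: progresses_def value.intros)
  then have "progresses (MkPair M N)" if "value S M"
    using progresses_plug[of N "FPairR M"] 6 that by (auto intro: has_type.intros)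
  then show ?case
    using progresses_plug[of M "FPairL N"] 6 by (auto intro: has_type.intros)
next
  case (7 M A B)
  have "progresses (Fst M)" if "value S M"
    using that 7(1)
    by (rule value_Prod_cases) (blast intro: progresses_step reduces.intros)+
  then show ?case
    using progresses_plug[of M FFst] 7 by (auto intro: has_type.intros)
next
  case (8 M A B)
  have "progresses (Snd M)" if "value S M"
    using that 8(1)
    by (rule value_Prod_cases) (blast intro: progresses_step reduces.intros)+
  then show ?case
    using progresses_plug[of M FSnd] 8 by (auto intro: has_type.intros)
next
  case (9 M A B)
  have "progresses (InL B M)" if "value S M"
    using that by (simp add: progresses_def value.intros)
  then show ?case
    using progresses_plug[of M "FInL B"] 9 by (auto intro: has_type.intros)
next
  case (10 M B A)
  have "progresses (InR A M)" if "value S M"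
    using that by (simp add: progresses_def value.intros)
  then show ?case
    using progresses_plug[of M "FInR A"] 10 by (auto intro: has_type.intros)
next
  case (11 L A1 A2 M B N)
  have "progresses (Case L M N)" if "value S L"
    using that 11(1)
    by (rule value_Sum_cases) (blast intro: progresses_step reduces.intros)+
  then show ?case
    using progresses_plug[of L "FCase M N"] 11 by (auto intro: has_type.intros)
next
  case (12 M A c B)
  \<comment> \<open>An active cast fires \<open>apply_cast\<close>; an inert one makes the whole
    term a value.\<close>
  have "progresses (Cast M c)" if "value S M"
    using that active_or_inert[of c] 12(3)
    by (auto simp: is_cast_def progresses_def intro: value.intros reduces.intros)
  then show ?case
    using progresses_plug[of M "FCast c"] 12 by (auto intro: has_type.intros)
next
  case (13 A l)
  then show ?case by (simp add: progresses_def)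
qed

end

theorem theorem11:
  fixes S :: "('c, 'l) cast_struct" and M :: "('c, 'l) trm" and A :: ty
  assumes "cast_struct S" and "has_type S [] M A"
  shows "(\<exists>M'. has_type S [] M' A \<and> reduces S [] M M') \<or> value S M \<or> (\<exists>l. M = Blame A l)"
proof -
  interpret cast_struct S by fact
  from progress[OF assms(2)] consider
      M' where "reduces S [] M M'"
    | "value S M"
    | B l where "M = Blame B l"
    unfolding progresses_def by blast
  then show ?thesis
  proof cases
    case 1
    then show ?thesis using preservation assms(2) by blast
  next
    case 3
    \<comment> \<open>Inverting the typing of \<open>Blame B l\<close> forces
      \<open>B = A\<close>.\<close>
    then show ?thesis using assms(2) by (auto elim: has_type_elims)
  qed simp
qed

end
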